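(* Let $X=(x_j:0\le j\le N)$ be a partition of $[a,b]$. Given a data set $Y$, suppose that $t_\alpha[Y]\in T_\alpha^2(X)$ interpolates $Y$ with type I (respectively II, III) end conditions. For $i=0,1,$ or $2$ and sufficiently small $\alpha$, $$\|D^i(\sigma[Y]-t_\alpha[Y])\|_{L^\infty[a,b]}\le C(\alpha\overline{h})^{4-i}\max\left\{\|\sigma'''\|_{L^\infty([a,b]\setminus X)},\ \|\sigma''\|_{L^\infty(X)}\right\},$$ where $\sigma=\sigma[Y]$ is the cubic spline interpolant of $Y$ with type I (respectively II, III) end conditions and $C>0$ is a constant independent of $\overline{h}$.
   Context: A partition of $[a,b]$ is a sequence $X=(x_j:0\le j\le N)$ with $a=x_0<x_1<\cdots<x_N=b$; its mesh size is $\overline{h}=\max_{1\le j\le N}(x_j-x_{j-1})$. A data set is $Y=(y_j:0\le j\le N)$, real values, together with the end data required by the type of end condition; a function $u$ interpolates $Y$ if $u(x_j)=y_j$ for $0\le j\le N$. For $\alpha>0$ (with $D=d/dx$), let $$S_\alpha^2(X)=\{s\in C^2[a,b]:(D^2-\alpha^2)^2s=0\text{ on }[a,b]\setminus X\},\qquad T_\alpha^2(X)=\{\operatorname{sech}(\alpha\,\cdot)\,u:u\in S_\alpha^2(X)\}.$$ Thus $T_\alpha^2(X)$ consists of the $C^2$ functions which on each $[x_{j-1},x_j]$ have the form $p(x)+q(x)\tanh(\alpha x)$ with $p,q$ polynomials of degree at most $1$. End conditions for a function $u$ on $[a,b]$: Type I: $u'(a)=y_0'$, $u'(b)=y_N'$,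 for prescribed reals $y_0',y_N'$. Type II: $u''(a)=u''(b)=0$. Type III: $u''(a)=y_0''$, $u''(b)=y_N''$, for prescribed reals $y_0'',y_N''$. The cubic spline interpolant $\sigma[Y]$ with a given end condition is the unique $C^2$ function on $[a,b]$ that is a polynomial of degree at most $3$ on each $[x_{j-1},x_j]$, interpolates $Y$, and satisfies that end condition (with the same end data). The third derivative $\sigma'''$ is defined on $[a,b]\setminus X$, and $\|\sigma''\|_{L^\infty(X)}=\max_{0\le j\le N}|\sigma''(x_j)|$. *)

theory Defs
  imports "HOL-Analysis.Analysis" "HOL-Computational_Algebra.Polynomial"
begin

text \<open>
  \<open>Dn S k f\<close> is the \<open>k\<close>-th derivative of \<open>f\<close> relative to \<open>S\<close>. For \<open>S = {a..b}\<close> it is one-sided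
  at \<open>a\<close> and \<open>b\<close> and the ordinary derivative in the interior, so values of \<open>f\<close> outside \<open>[a,b]\<close>
  are irrelevant on \<open>[a,b]\<close>. It is meaningful only where the derivatives exist.
\<close>

primrec Dn :: "real set \<Rightarrow> nat \<Rightarrow> (real \<Rightarrow> real) \<Rightarrow> real \<Rightarrow> real" where
  "Dn S 0 f = f"
| "Dn S (Suc k) f = (\<lambda>x. vector_derivative (Dn S k f) (at x within S))"

definition C2_on :: "real set \<Rightarrow> (real \<Rightarrow> real) \<Rightarrow> bool" where
  "C2_on S f \<longleftrightarrow> f differentiable_on S \<and> Dn S 1 f differentiable_on S \<and> continuous_on S (Dn S 2 f)"

text \<open>A partition \<open>a = x\<^sub>0 < \<dots> < x\<^sub>N = b\<close> is a function on \<open>nat\<close> of which only the values at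
  indices \<open>\<le> N\<close> matter; likewise for the data values \<open>y\<^sub>0, \<dots>, y\<^sub>N\<close>.\<close>

definition is_partition :: "real \<Rightarrow> real \<Rightarrow> nat \<Rightarrow> (nat \<Rightarrow> real) \<Rightarrow> bool" where
  "is_partition a b N x \<longleftrightarrow> x 0 = a \<and> x N = b \<and> (\<forall>j\<in>{1..N}. x (j - 1) < x j)"

definition mesh_size :: "nat \<Rightarrow> (nat \<Rightarrow> real) \<Rightarrow> real" where
  "mesh_size N x = (MAX j\<in>{1..N}. x j - x (j - 1))"

definition knots :: "nat \<Rightarrow> (nat \<Rightarrow> real) \<Rightarrow> real set" where
  "knots N x = x ` {0..N}"

definition interpolates :: "nat \<Rightarrow> (nat \<Rightarrow> real) \<Rightarrow> (nat \<Rightarrow> real) \<Rightarrow> (real \<Rightarrow> real) \<Rightarrow> bool" where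
  "interpolates N x y u \<longleftrightarrow> (\<forall>j\<in>{0..N}. u (x j) = y j)"

text \<open>The real arguments are the prescribed end data at \<open>a\<close> and at \<open>b\<close>.\<close>

datatype end_data = TypeI real real | TypeII | TypeIII real real

fun end_condition :: "real \<Rightarrow> real \<Rightarrow> end_data \<Rightarrow> (real \<Rightarrow> real) \<Rightarrow> bool" where
  "end_condition a b (TypeI da db) u \<longleftrightarrow> Dn {a..b} 1 u a = da \<and> Dn {a..b} 1 u b = db"
| "end_condition a b TypeII u \<longleftrightarrow> Dn {a..b} 2 u a = 0 \<and> Dn {a..b} 2 u b = 0"
| "end_condition a b (TypeIII da db) u \<longleftrightarrow> Dn {a..b} 2 u a = da \<and> Dn {a..b} 2 u b = db"

definition helm :: "real set \<Rightarrow> real \<Rightarrow> (real \<Rightarrow> real) \<Rightarrow> real \<Rightarrow> real" where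
  "helm S \<alpha> f = (\<lambda>z. Dn S 2 f z - \<alpha>\<^sup>2 * f z)"

text \<open>The class \<open>S\<^sub>\<alpha>\<^sup>2(X)\<close>: the clause on \<open>differentiable\<close> makes the fourth derivative exist off
  the knots (which include \<open>a\<close> and \<open>b\<close>), so that \<open>(D\<^sup>2 - \<alpha>\<^sup>2)\<^sup>2 s\<close> is defined there.\<close>

definition S_space :: "real \<Rightarrow> real \<Rightarrow> nat \<Rightarrow> (nat \<Rightarrow> real) \<Rightarrow> real \<Rightarrow> (real \<Rightarrow> real) set" where
  "S_space a b N x \<alpha> = {s. C2_on {a..b} s \<and>
     (\<forall>z\<in>{a..b} - knots N x.
        (\<forall>k<4. Dn {a..b} k s differentiable (at z within {a..b})) \<and>
        helm {a..b} \<alpha> (helm {a..b} \<alpha> s) z = 0)}"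

definition sech :: "real \<Rightarrow> real" where
  "sech z = 1 / cosh z"

definition T_space :: "real \<Rightarrow> real \<Rightarrow> nat \<Rightarrow> (nat \<Rightarrow> real) \<Rightarrow> real \<Rightarrow> (real \<Rightarrow> real) set" where
  "T_space a b N x \<alpha> = {(\<lambda>z. sech (\<alpha> * z) * u z) | u. u \<in> S_space a b N x \<alpha>}"

definition is_cubic_spline_interpolant ::
  "real \<Rightarrow> real \<Rightarrow> nat \<Rightarrow> (nat \<Rightarrow> real) \<Rightarrow> (nat \<Rightarrow> real) \<Rightarrow> end_data \<Rightarrow> (real \<Rightarrow> real) \<Rightarrow> bool" where
  "is_cubic_spline_interpolant a b N x y e \<sigma> \<longleftrightarrow>
     C2_on {a..b} \<sigma> \<and>
     (\<forall>j\<in>{1..N}. \<exists>p::real poly. degree p \<le> 3 \<and> (\<forall>z\<in>{x (j - 1)..x j}. \<sigma> z = poly p z)) \<and>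
     interpolates N x y \<sigma> \<and> end_condition a b e \<sigma>"

text \<open>The norm of \<open>L\<^sup>\<infinity>(S)\<close>, as a supremum. Below it is only applied to functions that are bounded on
  \<open>S\<close>: continuous ones on \<open>[a,b]\<close>, one that is constant between knots, or \<open>S\<close> finite.
  On the first two kinds of set it agrees with the essential supremum.\<close>

definition Linf_norm :: "real set \<Rightarrow> (real \<Rightarrow> real) \<Rightarrow> real" where
  "Linf_norm S f = (SUP z\<in>S. \<bar>f z\<bar>)"

end

theory Submission
  imports Defs
begin

text \<open>
  Put \<open>w = (\<sigma> - t)''\<close> and \<open>\<tau> = tanh (\<alpha> \<cdot>)\<close>. Between knots the equation \<open>(D\<^sup>2 - \<alpha>\<^sup>2)\<^sup>2 u = 0\<close> for
  \<open>u = t cosh (\<alpha> \<cdot>)\<close> becomes \<open>t'''' + 4\<alpha>\<tau> t''' + 4\<alpha>\<^sup>2 t'' = 0\<close>, which has no terms in \<open>t\<close> and \<open>t'\<close>;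
  hence \<open>w'' + 4\<alpha>\<tau> w' = 4\<alpha>\<tau> \<sigma>''' + 4\<alpha>\<^sup>2 (\<sigma>'' - w)\<close>. The maximum principle with a quadratic barrier
  shows that \<open>w\<close> differs from its linear interpolant at the knots by a small amount \<open>B\<close>, even if \<open>w'\<close>
  is large on very short intervals. The continuity of \<open>(\<sigma> - t)'\<close> at the knots then gives, as for cubic
  splines, a diagonally dominant system for the values of \<open>w\<close> at the knots, so that \<open>\<bar>w\<bar> \<le> 7 B\<close>. The
  part of \<open>B\<close> proportional to \<open>sup \<bar>w\<bar>\<close> is absorbed for small \<open>\<alpha>\<close>. Finally \<open>\<sigma> - t\<close> vanishes at all
  knots, so the estimate of \<open>w\<close> can be integrated.
\<close>

section \<open>Maximum principle\<close>

text \<open>At a positive interior maximum \<open>g1\<close> vanishes, so the hypothesis makes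
  \<open>g2\<close> positive there, which contradicts maximality. The coefficient
  \<open>\<beta>\<close> can be an arbitrary function because at that point it is multiplied by
  zero.\<close>

lemma max_principle:
  fixes g g1 g2 \<beta> :: "real \<Rightarrow> real"
  assumes cont: "continuous_on {p..q} g"
    and g1: "\<And>z. z \<in> {p<..<q} \<Longrightarrow> (g has_real_derivative g1 z) (at z)"
    and g2: "\<And>z. z \<in> {p<..<q} \<Longrightarrow> (g1 has_real_derivative g2 z) (at z)"
    and pos: "\<And>z. z \<in> {p<..<q} \<Longrightarrow> g2 z + \<beta> z * g1 z > 0"
    and ends: "g p \<le> 0" "g q \<le> 0"
    and z: "z \<in> {p..q}"
  shows "g z \<le> 0"
proof (rule ccontr)
  assume "\<not> g z \<le> 0"
  obtain m where m: "m \<in> {p..q}" "\<And>y. y \<in> {p..q} \<Longrightarrow> g y \<le> g m"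
    using continuous_attains_sup[OF compact_Icc _ cont] z by auto
  with \<open>\<not> g z \<le> 0\<close> z have "g m > 0" by fastforce
  with ends m have mi: "m \<in> {p<..<q}" by (cases "m = p"; cases "m = q") auto
  have "g1 m = 0"
  proof (rule DERIV_local_max[OF g1[OF mi]])
    show "0 < min (m - p) (q - m)" using mi by auto
    show "\<forall>y. \<bar>m - y\<bar> < min (m - p) (q - m) \<longrightarrow> g y \<le> g m"
      by (intro allI impI m(2)) auto
  qed
  with pos[OF mi] have "g2 m > 0" by simp
  then obtain d where d: "d > 0" "\<And>h. 0 < h \<Longrightarrow> h < d \<Longrightarrow> g1 (m + h) > 0"
    using DERIV_pos_inc_right[OF g2[OF mi]] \<open>g1 m = 0\<close> by metis
  define y where "y = m + min d (q - m) / 2"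
  have y: "m < y" "y < q" "y < m + d" using d mi by (auto simp: y_def min_def field_simps)
  have "\<exists>z>m. z < y \<and> g y - g m = (y - m) * g1 z"
    using y mi by (intro MVT2 g1) auto
  then obtain \<xi> where "m < \<xi>" "\<xi> < y" "g y - g m = (y - m) * g1 \<xi>" by auto
  moreover have "g1 \<xi> > 0" using d(2)[of "\<xi> - m"] \<open>m < \<xi>\<close> \<open>\<xi> < y\<close> y by simp
  ultimately have "g y > g m" using y mult_pos_pos[of "y - m" "g1 \<xi>"] by linarith
  with m(2)[of y] y mi show False by auto
qed

text \<open>The barrier \<open>G * ((y - p) * (q - y))\<close> has second derivative
  \<open>- 2 * G\<close>. Smallness of \<open>L * (q - p)\<close> keeps its first-order term below
  \<open>G\<close>, so what remains still exceeds \<open>F\<close>. The factor 1/4 comes from the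
  maximum of the barrier.\<close>

lemma max_principle_bound:
  fixes r r1 r2 \<beta> :: "real \<Rightarrow> real"
  assumes pq: "p < q"
    and cont: "continuous_on {p..q} r"
    and r1: "\<And>z. z \<in> {p<..<q} \<Longrightarrow> (r has_real_derivative r1 z) (at z)"
    and r2: "\<And>z. z \<in> {p<..<q} \<Longrightarrow> (r1 has_real_derivative r2 z) (at z)"
    and F: "\<And>z. z \<in> {p<..<q} \<Longrightarrow> \<bar>r2 z + \<beta> z * r1 z\<bar> \<le> F"
    and L: "\<And>z. z \<in> {p<..<q} \<Longrightarrow> \<bar>\<beta> z\<bar> \<le> L" "L * (q - p) < 1"
    and ends: "r p = 0" "r q = 0"
    and z: "z \<in> {p..q}"
  shows "\<bar>r z\<bar> \<le> F * (q - p)\<^sup>2 / 4"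
proof -
  \<comment> \<open>The signs \<open>s = 1\<close> and \<open>s = -1\<close> give the upper and the
    lower bound. The maximum principle needs strict positivity, hence \<open>G > F\<close>; the
    passage to \<open>F\<close> follows below.\<close>
  have le: "s * r z \<le> G * ((z - p) * (q - z))" if s: "\<bar>s\<bar> = 1" and G: "G > F" for s G
  proof -
    define g where "g y = s * r y - G * ((y - p) * (q - y))" for y
    have mid: "(p + q) / 2 \<in> {p<..<q}" using pq by simp
    have "G > 0" using F[OF mid] G by linarith
    have "g z \<le> 0"
    proof (rule max_principle[where ?g1.0 = "\<lambda>y. s * r1 y - G * (p + q - 2 * y)"
          and ?g2.0 = "\<lambda>y. s * r2 y + 2 * G" and \<beta> = \<beta>, OF _ _ _ _ _ _ z])
      show "continuous_on {p..q} g" unfolding g_def by (intro continuous_intros cont)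
      fix y assume y: "y \<in> {p<..<q}"
      show "(g has_real_derivative s * r1 y - G * (p + q - 2 * y)) (at y)"
        unfolding g_def by (auto intro!: derivative_eq_intros r1 y simp: algebra_simps)
      show "((\<lambda>y. s * r1 y - G * (p + q - 2 * y)) has_real_derivative s * r2 y + 2 * G) (at y)"
        by (auto intro!: derivative_eq_intros r2 y)
      have "\<bar>\<beta> y * (p + q - 2 * y)\<bar> \<le> L * (q - p)"
        using y unfolding abs_mult by (intro mult_mono L(1)) (auto intro: order_trans[OF _ L(1)[OF y]])
      hence "G * (2 - \<beta> y * (p + q - 2 * y)) > G * 1"
        using L(2) \<open>G > 0\<close> by (intro mult_strict_left_mono) auto
      moreover have "\<bar>s * (r2 y + \<beta> y * r1 y)\<bar> \<le> F" using F[OF y] s by (simp add: abs_mult)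
      ultimately have "s * (r2 y + \<beta> y * r1 y) + G * (2 - \<beta> y * (p + q - 2 * y)) > 0"
        using G by linarith
      thus "s * r2 y + 2 * G + \<beta> y * (s * r1 y - G * (p + q - 2 * y)) > 0"
        by (simp add: algebra_simps)
    qed (auto simp: g_def ends)
    thus ?thesis by (simp add: g_def)
  qed
  have q4: "(z - p) * (q - z) \<le> (q - p)\<^sup>2 / 4"
    using zero_le_power2[of "(z - p) - (q - z)"] by (simp add: power2_eq_square algebra_simps)
  have q0: "0 \<le> (z - p) * (q - z)" using z by simp
  have "\<bar>r z\<bar> \<le> F * ((z - p) * (q - z))"
  proof (rule field_le_epsilon)
    fix \<epsilon> :: real assume "\<epsilon> > 0"
    \<comment> \<open>The added 1 keeps the denominator positive at the end points, where the
      product vanishes.\<close>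
    define \<delta> where "\<delta> = \<epsilon> / ((z - p) * (q - z) + 1)"
    have d: "\<delta> > 0" using \<open>\<epsilon> > 0\<close> q0 by (simp add: \<delta>_def)
    have "\<bar>r z\<bar> \<le> (F + \<delta>) * ((z - p) * (q - z))"
      using le[of 1 "F + \<delta>"] le[of "-1" "F + \<delta>"] d by auto
    also have "\<dots> = F * ((z - p) * (q - z)) + \<delta> * ((z - p) * (q - z))"
      by (rule distrib_right)
    also have "\<delta> * ((z - p) * (q - z)) \<le> \<delta> * ((z - p) * (q - z) + 1)"
      using d by (intro mult_left_mono) auto
    also have "\<dots> = \<epsilon>" using q0 by (simp add: \<delta>_def)
    finally show "\<bar>r z\<bar> \<le> F * ((z - p) * (q - z)) + \<epsilon>" by simp
  qed
  also have "\<dots> \<le> F * ((q - p)\<^sup>2 / 4)"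
  proof (rule mult_left_mono[OF q4])
    show "0 \<le> F" using F[of "(p + q) / 2"] pq by auto
  qed
  finally show ?thesis by simp
qed

section \<open>Deviation from linear interpolation\<close>

definition linterp :: "real \<Rightarrow> real \<Rightarrow> (real \<Rightarrow> real) \<Rightarrow> real \<Rightarrow> real" where
  "linterp p q w z = w p + (w q - w p) / (q - p) * (z - p)"

lemma abs_linterp_le:
  assumes "p < q" "z \<in> {p..q}" "\<bar>w p\<bar> \<le> M" "\<bar>w q\<bar> \<le> M"
  shows "\<bar>linterp p q w z\<bar> \<le> M"
proof -
  define s where "s = (z - p) / (q - p)"
  have s: "0 \<le> s" "s \<le> 1" using assms by (auto simp: s_def)
  have "linterp p q w z = (1 - s) * w p + s * w q"
    by (simp add: linterp_def s_def algebra_simps diff_divide_distrib)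
  also have "\<bar>\<dots>\<bar> \<le> (1 - s) * \<bar>w p\<bar> + s * \<bar>w q\<bar>"
    using s by (intro order_trans[OF abs_triangle_ineq]) (simp add: abs_mult)
  also have "\<dots> \<le> (1 - s) * M + s * M" using s assms by (intro add_mono mult_left_mono) auto
  finally show ?thesis by (simp add: algebra_simps)
qed

text \<open>Subtracting the interpolant makes both end values zero and only adds a term
  \<open>\<beta> * k\<close> with the slope \<open>k\<close>. On a short interval \<open>k\<close>
  may be huge, but the quadratic factor of the barrier turns it into the difference of the end
  values times \<open>q - p\<close>.\<close>

lemma linterp_deviation:
  fixes w w1 w2 \<beta> :: "real \<Rightarrow> real"
  assumes pq: "p < q"
    and cont: "continuous_on {p..q} w"
    and w1: "\<And>z. z \<in> {p<..<q} \<Longrightarrow> (w has_real_derivative w1 z) (at z)"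
    and w2: "\<And>z. z \<in> {p<..<q} \<Longrightarrow> (w1 has_real_derivative w2 z) (at z)"
    and G: "\<And>z. z \<in> {p<..<q} \<Longrightarrow> \<bar>w2 z + \<beta> z * w1 z\<bar> \<le> G"
    and L: "\<And>z. z \<in> {p<..<q} \<Longrightarrow> \<bar>\<beta> z\<bar> \<le> L" "L * (q - p) < 1"
    and z: "z \<in> {p..q}"
  shows "\<bar>w z - linterp p q w z\<bar> \<le> G * (q - p)\<^sup>2 / 4 + L * (q - p) * \<bar>w q - w p\<bar> / 4"
proof -
  define k where "k = (w q - w p) / (q - p)"
  have lin: "linterp p q w y = w p + k * (y - p)" for y by (simp add: linterp_def k_def)
  have "\<bar>w z - linterp p q w z\<bar> \<le> (G + L * \<bar>k\<bar>) * (q - p)\<^sup>2 / 4"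
  proof (rule max_principle_bound[where ?r1.0 = "\<lambda>y. w1 y - k" and ?r2.0 = w2 and \<beta> = \<beta> and L = L
          and r = "\<lambda>z. w z - linterp p q w z", OF pq _ _ _ _ L _ _ z])
    show "continuous_on {p..q} (\<lambda>z. w z - linterp p q w z)"
      unfolding lin by (intro continuous_intros cont)
    fix y assume y: "y \<in> {p<..<q}"
    show "((\<lambda>z. w z - linterp p q w z) has_real_derivative w1 y - k) (at y)"
      unfolding lin by (auto intro!: derivative_eq_intros w1 y)
    show "((\<lambda>y. w1 y - k) has_real_derivative w2 y) (at y)"
      by (auto intro!: derivative_eq_intros w2 y)
    have "\<bar>\<beta> y * k\<bar> \<le> L * \<bar>k\<bar>" unfolding abs_mult by (intro mult_right_mono L y) simp
    thus "\<bar>w2 y + \<beta> y * (w1 y - k)\<bar> \<le> G + L * \<bar>k\<bar>"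
      using G[OF y] by (simp add: algebra_simps)
  qed (use pq in \<open>auto simp: linterp_def\<close>)
  also have "\<bar>k\<bar> = \<bar>w q - w p\<bar> / (q - p)" using pq by (simp add: k_def)
  also have "(G + L * (\<bar>w q - w p\<bar> / (q - p))) * (q - p)\<^sup>2 / 4
      = G * (q - p)\<^sup>2 / 4 + L * (q - p) * \<bar>w q - w p\<bar> / 4"
    using pq by (simp add: field_simps power2_eq_square)
  finally show ?thesis .
qed

section \<open>Functions vanishing at the knots\<close>

text \<open>Rolle's theorem gives a zero of \<open>f1\<close>. Integrating \<open>f2\<close> from
  there, and then \<open>f1\<close> from \<open>p\<close>, costs one factor \<open>q - p\<close>
  each.\<close>

lemma vanishing_ends_bounds:
  fixes f f1 f2 :: "real \<Rightarrow> real"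
  assumes pq: "p < q"
    and f1: "\<And>z. z \<in> {p..q} \<Longrightarrow> (f has_real_derivative f1 z) (at z within {p..q})"
    and f2: "\<And>z. z \<in> {p..q} \<Longrightarrow> (f1 has_real_derivative f2 z) (at z within {p..q})"
    and B: "\<And>z. z \<in> {p..q} \<Longrightarrow> \<bar>f2 z\<bar> \<le> B"
    and ends: "f p = 0" "f q = 0"
    and z: "z \<in> {p..q}"
  shows "\<bar>f1 z\<bar> \<le> B * (q - p)" "\<bar>f z\<bar> \<le> B * (q - p)\<^sup>2"
proof -
  have B0: "0 \<le> B" using B[OF z] by linarith
  have "\<exists>y>p. y < q \<and> f q - f p = (q - p) * f1 y"
  proof -
    have "continuous_on {p..q} f"
      using f1 by (intro DERIV_continuous_on)
    moreover have "(f has_real_derivative f1 y) (at y)" if "p < y" "y < q" for y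
      using f1[of y] that by (simp add: at_within_Icc_at)
    ultimately show ?thesis
      using mvt[OF pq, of f "\<lambda>y. (*) (f1 y)"]
      by (metis has_field_derivative_imp_has_derivative mult.commute)
  qed
  then obtain y where "p < y" "y < q" "f1 y = 0" using ends pq by auto
  hence y: "y \<in> {p..q}" "f1 y = 0" by auto
  have 1: "\<bar>f1 z\<bar> \<le> B * (q - p)" if z: "z \<in> {p..q}" for z
  proof -
    have "norm (f1 z - f1 y) \<le> B * norm (z - y)"
      using B by (intro field_differentiable_bound[OF convex_real_interval(5) f2 _ _ ]) (use y z in auto)
    also have "\<dots> \<le> B * (q - p)" using y z B0 by (intro mult_left_mono) auto
    finally show ?thesis using y by simp
  qed
  from 1[OF z] show "\<bar>f1 z\<bar> \<le> B * (q - p)" .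
  have "norm (f z - f p) \<le> B * (q - p) * norm (z - p)"
    using 1 by (intro field_differentiable_bound[OF convex_real_interval(5) f1]) (use z in auto)
  also have "\<dots> \<le> B * (q - p) * (q - p)" using z B0 by (intro mult_left_mono) auto
  finally show "\<bar>f z\<bar> \<le> B * (q - p)\<^sup>2" using ends by (simp add: power2_eq_square mult.assoc)
qed

text \<open>If \<open>f2\<close> were linear, \<open>f\<close> would be a cubic whose end slopes are
  the classical expressions in the end values of \<open>f2\<close>. The difference from that cubic
  vanishes at both ends and has second derivative at most \<open>B\<close>, so its slopes are at
  most \<open>B * (q - p)\<close>.\<close>

lemma vanishing_ends_slopes:
  fixes f f1 f2 :: "real \<Rightarrow> real"
  assumes pq: "p < q"
    and f1: "\<And>z. z \<in> {p..q} \<Longrightarrow> (f has_real_derivative f1 z) (at z within {p..q})"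
    and f2: "\<And>z. z \<in> {p..q} \<Longrightarrow> (f1 has_real_derivative f2 z) (at z within {p..q})"
    and B: "\<And>z. z \<in> {p..q} \<Longrightarrow> \<bar>f2 z - linterp p q f2 z\<bar> \<le> B"
    and ends: "f p = 0" "f q = 0"
  shows "\<bar>f1 p + (q - p) * (f2 p / 3 + f2 q / 6)\<bar> \<le> B * (q - p)"
    and "\<bar>f1 q - (q - p) * (f2 p / 6 + f2 q / 3)\<bar> \<le> B * (q - p)"
proof -
  define h where "h = q - p"
  have h: "h > 0" "q - p = h" using pq by (auto simp: h_def)
  define k where "k = (f2 q - f2 p) / h"
  have k: "f2 q = f2 p + k * h" using h by (simp add: k_def)
  \<comment> \<open>The slope at \<open>p\<close> that makes the cubic below vanish at
    \<open>q\<close>.\<close>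
  define c where "c = - h * (f2 p / 3 + f2 q / 6)"
  txt \<open>\<open>P\<close> is the cubic with \<open>P p = P q = 0\<close> whose second derivative is the linear interpolant.\<close>
  define P1 where "P1 z = f2 p * (z - p) + k * (z - p)\<^sup>2 / 2 + c" for z
  define P where "P z = f2 p * (z - p)\<^sup>2 / 2 + k * (z - p) ^ 3 / 6 + c * (z - p)" for z
  have "\<bar>f1 z - P1 z\<bar> \<le> B * (q - p)" if z: "z \<in> {p..q}" for z
  proof (rule vanishing_ends_bounds(1)[where f = "\<lambda>z. f z - P z" and ?f1.0 = "\<lambda>z. f1 z - P1 z"
        and ?f2.0 = "\<lambda>z. f2 z - linterp p q f2 z", OF pq _ _ B _ _ z])
    fix y assume y: "y \<in> {p..q}"
    show "((\<lambda>z. f z - P z) has_real_derivative f1 y - P1 y) (at y within {p..q})"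
      unfolding P_def P1_def
      by (auto intro!: derivative_eq_intros f1 y simp: power2_eq_square)
    show "((\<lambda>z. f1 z - P1 z) has_real_derivative f2 y - linterp p q f2 y) (at y within {p..q})"
      unfolding P1_def linterp_def h(2) k_def[symmetric]
      by (auto intro!: derivative_eq_intros f2 y)
  next
    show "f p - P p = 0" by (simp add: P_def ends)
    have "P q = 0"
      unfolding P_def h(2) c_def k by (simp add: field_simps power2_eq_square power3_eq_cube)
    thus "f q - P q = 0" by (simp add: ends)
  qed
  from this[of p] this[of q] have "\<bar>f1 p - P1 p\<bar> \<le> B * h" "\<bar>f1 q - P1 q\<bar> \<le> B * h"
    using pq by (auto simp: h_def)
  moreover have "P1 p = - h * (f2 p / 3 + f2 q / 6)" by (simp add: P1_def c_def)
  moreover have "P1 q = h * (f2 p / 6 + f2 q / 3)"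
    unfolding P1_def h(2) c_def k by (simp add: field_simps power2_eq_square)
  ultimately show "\<bar>f1 p + (q - p) * (f2 p / 3 + f2 q / 6)\<bar> \<le> B * (q - p)"
    "\<bar>f1 q - (q - p) * (f2 p / 6 + f2 q / 3)\<bar> \<le> B * (q - p)"
    unfolding h(2) by auto
qed

section \<open>Partitions\<close>

lemma partition_less:
  assumes "is_partition a b N x" "i < j" "j \<le> N"
  shows "x i < x j"
  using assms(2,3)
proof (induction j)
  case (Suc j)
  have "x j < x (Suc j)" using assms(1) Suc.prems by (auto simp: is_partition_def dest: bspec[of _ _ "Suc j"])
  with Suc show ?case by (cases "i = j") auto
qed simp

lemma partition_le:
  assumes "is_partition a b N x" "i \<le> j" "j \<le> N"
  shows "x i \<le> x j"
  using partition_less[OF assms(1), of i j] assms by (cases "i = j") auto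

lemma partition_step:
  assumes "is_partition a b N x" "j \<in> {1..N}"
  shows "x (j - 1) < x j" "a \<le> x (j - 1)" "x j \<le> b" "x j - x (j - 1) \<le> mesh_size N x"
  using assms partition_le[OF assms(1), of 0 "j - 1"] partition_le[OF assms(1), of j N]
  by (auto simp: is_partition_def mesh_size_def)

lemma partition_cover:
  assumes "is_partition a b N x" "a < b" "z \<in> {a..b}"
  obtains j where "j \<in> {1..N}" "z \<in> {x (j - 1)..x j}"
proof -
  have N: "x 0 = a" "x N = b" using assms by (auto simp: is_partition_def)
  with assms(2) have N0: "N \<noteq> 0" by (metis less_irrefl)
  \<comment> \<open>The condition \<open>1 \<le> j\<close> excludes index 0, where truncated
    subtraction would give a one-point interval.\<close>
  define j where "j = (LEAST j. 1 \<le> j \<and> z \<le> x j)"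
  have ex: "1 \<le> N \<and> z \<le> x N" using N N0 assms(3) by auto
  have j: "1 \<le> j" "z \<le> x j" "j \<le> N"
    using LeastI[of "\<lambda>j. 1 \<le> j \<and> z \<le> x j", OF ex] Least_le[of "\<lambda>j. 1 \<le> j \<and> z \<le> x j", OF ex]
    by (auto simp: j_def)
  have "x (j - 1) \<le> z"
  proof (cases "j = 1")
    case False
    hence "\<not> (1 \<le> j - 1 \<and> z \<le> x (j - 1))"
      unfolding j_def using j(1) by (intro not_less_Least) (simp add: j_def)
    with False j show ?thesis by auto
  qed (use N assms in auto)
  with j that show ?thesis by auto
qed

lemma partition_gap_no_knots:
  assumes "is_partition a b N x" "j \<in> {1..N}"
  shows "{x (j - 1)<..<x j} \<subseteq> {a..b} - knots N x"
proof
  fix z assume z: "z \<in> {x (j - 1)<..<x j}"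
  have "z \<noteq> x i" if i: "i \<le> N" for i
  proof (cases "i < j")
    case True
    hence "x i \<le> x (j - 1)" using assms(2) by (intro partition_le[OF assms(1)]) auto
    with z show ?thesis by auto
  next
    case False
    hence "x j \<le> x i" using i by (intro partition_le[OF assms(1)]) auto
    with z show ?thesis by auto
  qed
  thus "z \<in> {a..b} - knots N x"
    using z partition_step[OF assms] by (fastforce simp: knots_def)
qed

section \<open>From single subintervals to the whole partition\<close>

lemma vanishing_knots_bounds:
  fixes e e1 e2 :: "real \<Rightarrow> real"
  assumes part: "is_partition a b N x" and ab: "a < b"
    and e1: "\<And>z. z \<in> {a..b} \<Longrightarrow> (e has_real_derivative e1 z) (at z within {a..b})"
    and e2: "\<And>z. z \<in> {a..b} \<Longrightarrow> (e1 has_real_derivative e2 z) (at z within {a..b})"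
    and W: "\<And>z. z \<in> {a..b} \<Longrightarrow> \<bar>e2 z\<bar> \<le> W"
    and zero: "\<And>j. j \<le> N \<Longrightarrow> e (x j) = 0"
    and z: "z \<in> {a..b}"
  shows "\<bar>e1 z\<bar> \<le> W * mesh_size N x" "\<bar>e z\<bar> \<le> W * (mesh_size N x)\<^sup>2"
proof -
  obtain j where j: "j \<in> {1..N}" "z \<in> {x (j - 1)..x j}"
    using partition_cover[OF part ab z] .
  note st = partition_step[OF part j(1)]
  have W0: "W \<ge> 0" using W[OF z] by linarith
  have sub: "{x (j - 1)..x j} \<subseteq> {a..b}" using st by auto
  have e1': "(e has_real_derivative e1 y) (at y within {x (j - 1)..x j})"
    and e2': "(e1 has_real_derivative e2 y) (at y within {x (j - 1)..x j})"
    if "y \<in> {x (j - 1)..x j}" for y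
    using DERIV_subset[OF e1 sub] DERIV_subset[OF e2 sub] that sub by auto
  have W': "\<bar>e2 y\<bar> \<le> W" if "y \<in> {x (j - 1)..x j}" for y using that sub W by auto
  note * = vanishing_ends_bounds[OF st(1) e1' e2' W'
      zero zero j(2)]
  have *: "\<bar>e1 z\<bar> \<le> W * (x j - x (j - 1))" "\<bar>e z\<bar> \<le> W * (x j - x (j - 1))\<^sup>2"
    using * j(1) by auto
  show "\<bar>e1 z\<bar> \<le> W * mesh_size N x"
    using *(1) st(4) W0 by (meson mult_left_mono order_trans)
  show "\<bar>e z\<bar> \<le> W * (mesh_size N x)\<^sup>2"
    using *(2) st(1,4) W0 by (meson mult_left_mono order_trans power_mono diff_ge_0_iff_ge less_imp_le)
qed

text \<open>The slope at an inner knot is known, up to \<open>B\<close> times a step length, from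
  the subintervals on both sides. Equating the two expressions gives a row of the spline system with
  diagonal entry \<open>(h + k) / 3\<close> and off-diagonal sum \<open>(h + k) / 6\<close>.
  Dominance bounds the knot values by \<open>6 * B\<close>; a further \<open>B\<close> covers the
  points between knots.\<close>

lemma vanishing_knots_second_derivative:
  fixes e e1 e2 :: "real \<Rightarrow> real"
  assumes part: "is_partition a b N x" and ab: "a < b"
    and e1: "\<And>z. z \<in> {a..b} \<Longrightarrow> (e has_real_derivative e1 z) (at z within {a..b})"
    and e2: "\<And>z. z \<in> {a..b} \<Longrightarrow> (e1 has_real_derivative e2 z) (at z within {a..b})"
    and zero: "\<And>j. j \<le> N \<Longrightarrow> e (x j) = 0"
    and ends: "e1 a = 0 \<and> e1 b = 0 \<or> e2 a = 0 \<and> e2 b = 0"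
    and B: "\<And>j z. j \<in> {1..N} \<Longrightarrow> z \<in> {x (j - 1)..x j} \<Longrightarrow>
              \<bar>e2 z - linterp (x (j - 1)) (x j) e2 z\<bar> \<le> B"
    and z: "z \<in> {a..b}"
  shows "\<bar>e2 z\<bar> \<le> 7 * B"
proof -
  have xN: "x 0 = a" "x N = b" using part by (auto simp: is_partition_def)
  have slopes: "\<bar>e1 (x (j - 1)) + (x j - x (j - 1)) * (e2 (x (j - 1)) / 3 + e2 (x j) / 6)\<bar>
        \<le> B * (x j - x (j - 1))"
      "\<bar>e1 (x j) - (x j - x (j - 1)) * (e2 (x (j - 1)) / 6 + e2 (x j) / 3)\<bar>
        \<le> B * (x j - x (j - 1))" if j: "j \<in> {1..N}" for j
  proof -
    note st = partition_step[OF part j]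
    have sub: "{x (j - 1)..x j} \<subseteq> {a..b}" using st by auto
    have e1': "(e has_real_derivative e1 y) (at y within {x (j - 1)..x j})"
      and e2': "(e1 has_real_derivative e2 y) (at y within {x (j - 1)..x j})"
      if "y \<in> {x (j - 1)..x j}" for y
      using DERIV_subset[OF e1 sub] DERIV_subset[OF e2 sub] that sub by auto
    show "\<bar>e1 (x (j - 1)) + (x j - x (j - 1)) * (e2 (x (j - 1)) / 3 + e2 (x j) / 6)\<bar>
        \<le> B * (x j - x (j - 1))"
      "\<bar>e1 (x j) - (x j - x (j - 1)) * (e2 (x (j - 1)) / 6 + e2 (x j) / 3)\<bar>
        \<le> B * (x j - x (j - 1))"
      using vanishing_ends_slopes[OF st(1) e1' e2' B[OF j]
          zero zero] j by auto
  qed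
  \<comment> \<open>No matrix is inverted: the row of a knot with largest absolute value of
    \<open>e2\<close> suffices.\<close>
  obtain j where j: "j \<le> N" and jmax: "\<And>i. i \<le> N \<Longrightarrow> \<bar>e2 (x i)\<bar> \<le> \<bar>e2 (x j)\<bar>"
  proof -
    have "\<exists>j\<in>{..N}. \<forall>i\<in>{..N}. \<bar>e2 (x i)\<bar> \<le> \<bar>e2 (x j)\<bar>"
      using Max_in[of "(\<lambda>i. \<bar>e2 (x i)\<bar>) ` {..N}"] Max_ge[of "(\<lambda>i. \<bar>e2 (x i)\<bar>) ` {..N}"]
      by fastforce
    thus ?thesis using that by auto
  qed
  have N0: "N \<noteq> 0" using xN ab by (metis less_irrefl)
  have B0: "B \<ge> 0" using B[of 1 "x 0"] partition_step[OF part, of 1] N0 by auto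
  define m where "m = e2 (x j)"
  \<comment> \<open>This is dominance in the row of an end knot: the neighbour can cancel at most
    half of \<open>m / 3\<close>.\<close>
  have diag: "h * \<bar>m\<bar> / 6 \<le> \<bar>h * (m / 3 + n / 6)\<bar>" if "h > 0" "\<bar>n\<bar> \<le> \<bar>m\<bar>" for h n
  proof -
    have "h * (\<bar>m\<bar> / 6) \<le> h * \<bar>m / 3 + n / 6\<bar>"
      using that by (intro mult_left_mono) (auto simp: abs_if split: if_splits)
    thus ?thesis using that by (simp add: abs_mult)
  qed
  have "\<bar>m\<bar> \<le> 6 * B"
  proof -
    consider "j = 0" | "j = N" "j \<noteq> 0" | "j \<noteq> 0" "j < N" using j by linarith
    thus ?thesis
    proof cases
      case 1
      show ?thesis
      proof (cases "e2 a = 0")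
        case True thus ?thesis using B0 1 xN by (simp add: m_def)
      next
        \<comment> \<open>A nonzero \<open>e2 a\<close> selects the alternative
          \<open>e1 a = 0\<close> in \<open>ends\<close>, so the slope formula reduces to a row in
          \<open>m\<close> and its one neighbour.\<close>
        case False
        define h where "h = x 1 - x 0"
        have h: "h > 0" using partition_step[OF part, of 1] N0 by (auto simp: h_def)
        have "h * \<bar>m\<bar> / 6 \<le> \<bar>h * (m / 3 + e2 (x 1) / 6)\<bar>"
          using diag[OF h, of "e2 (x 1)"] jmax[of 1] N0 by (auto simp: m_def)
        also have "\<dots> \<le> B * h"
          using slopes(1)[of 1] N0 ends False 1 xN by (auto simp: h_def m_def)
        finally have "h * \<bar>m\<bar> \<le> h * (6 * B)" by (simp add: mult_ac)
        thus ?thesis using h by simp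
      qed
    next
      case 2
      show ?thesis
      proof (cases "e2 b = 0")
        case True thus ?thesis using B0 2 xN by (simp add: m_def)
      next
        case False
        define h where "h = x N - x (N - 1)"
        have h: "h > 0" using partition_step[OF part, of N] N0 by (auto simp: h_def)
        have "h * \<bar>m\<bar> / 6 \<le> \<bar>h * (m / 3 + e2 (x (N - 1)) / 6)\<bar>"
          using diag[OF h, of "e2 (x (N - 1))"] jmax[of "N - 1"] N0 by (auto simp: m_def)
        also have "\<dots> \<le> B * h"
          using slopes(2)[of N] N0 ends False 2 xN by (auto simp: h_def m_def add.commute)
        finally have "h * \<bar>m\<bar> \<le> h * (6 * B)" by (simp add: mult_ac)
        thus ?thesis using h by simp
      qed
    next
      case 3
      define h where "h = x j - x (j - 1)"
      define k where "k = x (Suc j) - x j"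
      define n where "n = e2 (x (j - 1))"
      define n' where "n' = e2 (x (Suc j))"
      have hk: "h > 0" "k > 0"
        using partition_step[OF part, of j] partition_step[OF part, of "Suc j"] 3
        by (auto simp: h_def k_def)
      have n: "\<bar>n\<bar> \<le> \<bar>m\<bar>" "\<bar>n'\<bar> \<le> \<bar>m\<bar>" using jmax 3 by (auto simp: n_def n'_def m_def)
      have "\<bar>e1 (x j) - h * (n / 6 + m / 3)\<bar> \<le> B * h"
        using slopes(2)[of j] 3 by (auto simp: h_def n_def m_def)
      moreover have "\<bar>e1 (x j) + k * (m / 3 + n' / 6)\<bar> \<le> B * k"
        using slopes(1)[of "Suc j"] 3 by (auto simp: k_def n'_def m_def)
      ultimately have "\<bar>h * (n / 6 + m / 3) + k * (m / 3 + n' / 6)\<bar> \<le> B * (h + k)"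
        by (simp add: distrib_left)
      moreover have "(h + k) * \<bar>m\<bar> / 6 \<le> \<bar>h * (n / 6 + m / 3) + k * (m / 3 + n' / 6)\<bar>"
      proof -
        have "h * (n / 6 + m / 3) + k * (m / 3 + n' / 6)
            = (h + k) * (m / 3) + (h * n / 6 + k * n' / 6)" by (simp add: algebra_simps)
        hence "\<bar>(h + k) * (m / 3)\<bar> - \<bar>h * n / 6 + k * n' / 6\<bar>
            \<le> \<bar>h * (n / 6 + m / 3) + k * (m / 3 + n' / 6)\<bar>"
          by linarith
        moreover have "\<bar>h * n / 6 + k * n' / 6\<bar> \<le> h * \<bar>n\<bar> / 6 + k * \<bar>n'\<bar> / 6"
          using hk by (intro order_trans[OF abs_triangle_ineq]) (simp add: abs_mult)
        moreover have "\<bar>(h + k) * (m / 3)\<bar> = (h * \<bar>m\<bar> + k * \<bar>m\<bar>) / 3"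
          using hk by (simp add: abs_mult flip: distrib_right)
        moreover have "h * \<bar>n\<bar> \<le> h * \<bar>m\<bar>" "k * \<bar>n'\<bar> \<le> k * \<bar>m\<bar>" using hk n by auto
        moreover have "(h + k) * \<bar>m\<bar> / 6 = (h * \<bar>m\<bar> + k * \<bar>m\<bar>) / 6" by (simp add: distrib_right)
        ultimately show ?thesis by argo
      qed
      ultimately have "(h + k) * \<bar>m\<bar> / 6 \<le> B * (h + k)" by linarith
      hence "(h + k) * \<bar>m\<bar> \<le> (h + k) * (6 * B)" by (simp add: field_simps)
      thus ?thesis using hk by simp
    qed
  qed
  obtain i where i: "i \<in> {1..N}" "z \<in> {x (i - 1)..x i}" using partition_cover[OF part ab z] .
  have "\<bar>e2 (x k)\<bar> \<le> 6 * B" if "k \<le> N" for k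
    using jmax[OF that] \<open>\<bar>m\<bar> \<le> 6 * B\<close> by (simp add: m_def)
  hence "\<bar>linterp (x (i - 1)) (x i) e2 z\<bar> \<le> 6 * B"
    using i partition_step(1)[OF part i(1)] by (intro abs_linterp_le) auto
  with B[OF i] show ?thesis by linarith
qed


section \<open>The relative derivatives \<open>Dn\<close>\<close>

lemma C2_on_derivatives:
  assumes "a < b" "C2_on {a..b} f" "z \<in> {a..b}"
  shows "(f has_real_derivative Dn {a..b} 1 f z) (at z within {a..b})"
    and "(Dn {a..b} 1 f has_real_derivative Dn {a..b} 2 f z) (at z within {a..b})"
proof -
  have *: "(g has_real_derivative vector_derivative g (at z within {a..b})) (at z within {a..b})"
    if "g differentiable_on {a..b}" for g
    using that assms by (simp add: has_real_derivative_iff_has_vector_derivative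
        vector_derivative_works[symmetric] differentiable_on_def)
  show "(f has_real_derivative Dn {a..b} 1 f z) (at z within {a..b})"
    using *[of f] assms by (simp add: C2_on_def)
  show "(Dn {a..b} 1 f has_real_derivative Dn {a..b} 2 f z) (at z within {a..b})"
    using *[of "Dn {a..b} 1 f"] assms by (simp add: C2_on_def numeral_2_eq_2)
qed

lemma Dn_1_eqI:
  assumes "a < b" "z \<in> {a..b}" "(f has_real_derivative d) (at z within {a..b})"
  shows "Dn {a..b} 1 f z = d"
  using assms by (simp add: vector_derivative_within_closed_interval
      has_real_derivative_iff_has_vector_derivative)

lemma Dn_2_eqI:
  assumes "a < b" "z \<in> {a..b}"
    and f1: "\<And>y. y \<in> {a..b} \<Longrightarrow> (f has_real_derivative f1 y) (at y within {a..b})"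
    and f2: "(f1 has_real_derivative d) (at z within {a..b})"
  shows "Dn {a..b} 2 f z = d"
proof -
  have "(Dn {a..b} 1 f has_real_derivative d) (at z within {a..b})"
    using Dn_1_eqI[OF assms(1) _ f1] assms(2)
    by (intro has_field_derivative_transform_within[OF f2, of 1]) auto
  from Dn_1_eqI[OF assms(1,2) this] show ?thesis by (simp add: numeral_2_eq_2)
qed

text \<open>Inside an open \<open>U\<close> relative derivatives are ordinary ones. Agreement with
  \<open>g\<close> on all of \<open>U\<close>, and not only at \<open>z\<close>, is what permits a
  further differentiation.\<close>

lemma Dn_Suc_open:
  assumes "open U" "U \<subseteq> S" "z \<in> U"
    and eq: "\<And>y. y \<in> U \<Longrightarrow> Dn S k f y = g y"
    and g: "(g has_real_derivative d) (at z)"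
  shows "(Dn S k f has_real_derivative d) (at z)" "Dn S (Suc k) f z = d"
proof -
  show 1: "(Dn S k f has_real_derivative d) (at z)"
    using has_field_derivative_transform_within_open[OF g assms(1,3)] eq by auto
  have "at z within S = at z" by (rule at_within_open_subset[OF assms(3,1,2)])
  with 1 show "Dn S (Suc k) f z = d"
    by (simp add: has_real_derivative_iff_has_vector_derivative vector_derivative_at)
qed

lemma Dn_differentiable_open:
  assumes "open U" "U \<subseteq> S" "z \<in> U" "Dn S k f differentiable (at z within S)"
  shows "(Dn S k f has_real_derivative Dn S (Suc k) f z) (at z)"
proof -
  have "at z within S = at z" by (rule at_within_open_subset[OF assms(3,1,2)])
  with assms(4) show ?thesis
    by (simp add: has_real_derivative_iff_has_vector_derivative vector_derivative_works)
qed

lemma Dn_poly_open: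
  assumes U: "open U" "U \<subseteq> S" and eq: "\<And>y. y \<in> U \<Longrightarrow> f y = poly p y" and z: "z \<in> U"
  shows "Dn S k f z = poly ((pderiv ^^ k) p) z"
  using z
proof (induction k arbitrary: z)
  case (Suc k)
  show ?case using Dn_Suc_open(2)[OF U Suc.prems Suc.IH poly_DERIV] by simp
qed (simp add: eq)

section \<open>Regularity of the two interpolants\<close>

text \<open>Three differentiations lower the degree to 0. As the third derivative is constant, the
  spline contributes no fourth derivative to the equation of the error.\<close>

lemma cubic_spline_gap:
  assumes U: "open U" "U \<subseteq> S" and p: "degree p \<le> 3" "\<And>y. y \<in> U \<Longrightarrow> \<sigma> y = poly p y"
  obtains c where "\<And>z. z \<in> U \<Longrightarrow> (Dn S 2 \<sigma> has_real_derivative c) (at z)"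
    "\<And>z. z \<in> U \<Longrightarrow> Dn S 3 \<sigma> z = c"
proof -
  have deg: "degree ((pderiv ^^ k) p) = degree p - k" for k
    by (induction k) (auto simp: degree_pderiv)
  have "degree ((pderiv ^^ 3) p) = 0" using deg[of 3] p by simp
  then obtain c where c: "(pderiv ^^ 3) p = [:c:]" by (elim degree_eq_zeroE)
  have eq: "Dn S k \<sigma> z = poly ((pderiv ^^ k) p) z" if "z \<in> U" for k z
    using Dn_poly_open[OF U p(2) that] .
  have pd: "poly (pderiv ((pderiv ^^ 2) p)) z = c" for z
    using c by (simp add: numeral_3_eq_3 numeral_2_eq_2)
  show ?thesis
  proof (rule that[of c])
    fix z assume z: "z \<in> U"
    show "(Dn S 2 \<sigma> has_real_derivative c) (at z)"
      using Dn_Suc_open(1)[OF U z eq poly_DERIV, of 2] pd by simp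
    show "Dn S 3 \<sigma> z = c" using eq[OF z, of 3] c by simp
  qed
qed

text \<open>This reads the fourth-order equation as a second-order one,
  \<open>v'' = \<alpha>\<^sup>2 v\<close> for \<open>v = helm {a..b} \<alpha> s\<close>. Existence
  of derivatives up to order four allows the outer operator to be expanded termwise.\<close>

lemma S_space_helm_derivatives:
  assumes s: "s \<in> S_space a b N x \<alpha>" and U: "open U" "U \<subseteq> {a..b} - knots N x"
  obtains v1 where
    "\<And>z. z \<in> U \<Longrightarrow> (helm {a..b} \<alpha> s has_real_derivative v1 z) (at z)"
    "\<And>z. z \<in> U \<Longrightarrow> (v1 has_real_derivative \<alpha>\<^sup>2 * helm {a..b} \<alpha> s z) (at z)"
proof -
  let ?S = "{a..b}"
  have US: "U \<subseteq> ?S" using U by auto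
  define v1 where "v1 z = Dn ?S 3 s z - \<alpha>\<^sup>2 * Dn ?S 1 s z" for z
  have D: "(Dn ?S k s has_real_derivative Dn ?S (Suc k) s z) (at z)" if "z \<in> U" "k < 4" for k z
    using s that U by (intro Dn_differentiable_open[OF U(1) US]) (auto simp: S_space_def)
  have v: "(helm ?S \<alpha> s has_real_derivative v1 z) (at z)" if "z \<in> U" for z
    unfolding helm_def v1_def using D[OF that, of 2] D[OF that, of 0]
    by (auto intro!: derivative_eq_intros simp: numeral_3_eq_3 numeral_2_eq_2)
  have v1: "(v1 has_real_derivative Dn ?S 4 s z - \<alpha>\<^sup>2 * Dn ?S 2 s z) (at z)" if "z \<in> U" for z
    unfolding v1_def using D[OF that, of 3] D[OF that, of 1]
    by (auto intro!: derivative_eq_intros simp: eval_nat_numeral)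
  show ?thesis
  proof (rule that[OF v])
    fix z assume z: "z \<in> U"
    have "Dn ?S 1 (helm ?S \<alpha> s) y = v1 y" if "y \<in> U" for y
      using Dn_Suc_open(2)[OF U(1) US that, of 0 "helm ?S \<alpha> s" "helm ?S \<alpha> s"] v[OF that] by simp
    from Dn_Suc_open(2)[OF U(1) US z this v1[OF z]]
    have "Dn ?S 2 (helm ?S \<alpha> s) z = Dn ?S 4 s z - \<alpha>\<^sup>2 * Dn ?S 2 s z" by (simp add: numeral_2_eq_2)
    moreover have "helm ?S \<alpha> (helm ?S \<alpha> s) z = 0" using s z U by (auto simp: S_space_def)
    ultimately show "(v1 has_real_derivative \<alpha>\<^sup>2 * helm ?S \<alpha> s z) (at z)"
      using v1[OF z] by (simp add: helm_def[of _ _ "helm ?S \<alpha> s"])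
  qed
qed

lemma has_real_derivative_sech [THEN DERIV_chain2, derivative_intros]:
  "(sech has_real_derivative - sech z * tanh z) (at z)"
  unfolding sech_def[abs_def] tanh_def
  by (auto intro!: derivative_eq_intros simp: power2_eq_square)

text \<open>With \<open>v = (D\<^sup>2 - \<alpha>\<^sup>2) u\<close> and \<open>t = sech (\<alpha> \<cdot>) u\<close> one has \<open>t'' = sech (\<alpha> \<cdot>) v - 2 \<alpha> \<tau> t'\<close>.\<close>

lemma T_space_derivatives:
  assumes ab: "a < b" and t: "t \<in> T_space a b N x \<alpha>"
  obtains t1 t2 where
    "\<And>z. z \<in> {a..b} \<Longrightarrow> (t has_real_derivative t1 z) (at z within {a..b})"
    "\<And>z. z \<in> {a..b} \<Longrightarrow> (t1 has_real_derivative t2 z) (at z within {a..b})"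
    "continuous_on {a..b} t2"
    "\<And>U. open U \<Longrightarrow> U \<subseteq> {a..b} - knots N x \<Longrightarrow> \<exists>t3. \<forall>z\<in>U. (t2 has_real_derivative t3 z) (at z) \<and>
       (t3 has_real_derivative - 4 * \<alpha> * tanh (\<alpha> * z) * t3 z - 4 * \<alpha>\<^sup>2 * t2 z) (at z)"
proof -
  let ?S = "{a..b}"
  obtain u where tu: "t = (\<lambda>z. sech (\<alpha> * z) * u z)" and u: "u \<in> S_space a b N x \<alpha>"
    using t by (auto simp: T_space_def)
  have C2: "C2_on ?S u" using u by (simp add: S_space_def)
  note Du = C2_on_derivatives[OF ab C2]
  define k where "k z = sech (\<alpha> * z)" for z
  define \<tau> where "\<tau> z = tanh (\<alpha> * z)" for z
  define v where "v = helm ?S \<alpha> u"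
  \<comment> \<open>The product rule with \<open>k' = - \<alpha> \<tau> k\<close>. Writing
    \<open>t2\<close> through \<open>v\<close> and \<open>t1\<close> prepares the elimination of
    \<open>u\<close>.\<close>
  define t1 where "t1 z = k z * (Dn ?S 1 u z - \<alpha> * \<tau> z * u z)" for z
  define t2 where "t2 z = k z * v z - 2 * \<alpha> * \<tau> z * t1 z" for z
  have k': "(k has_real_derivative - \<alpha> * \<tau> z * k z) (at z within A)" for z A
    unfolding k_def \<tau>_def by (auto intro!: derivative_eq_intros)
  have \<tau>': "(\<tau> has_real_derivative \<alpha> * (1 - (\<tau> z)\<^sup>2)) (at z within A)" for z A
    unfolding \<tau>_def by (auto intro!: derivative_eq_intros)
  have t': "(t has_real_derivative t1 z) (at z within ?S)" if "z \<in> ?S" for z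
  proof -
    have "((\<lambda>z. k z * u z) has_real_derivative t1 z) (at z within ?S)"
      unfolding t1_def by (auto intro!: derivative_eq_intros k' Du that simp: algebra_simps)
    thus ?thesis by (simp add: tu k_def)
  qed
  have t1': "(t1 has_real_derivative t2 z) (at z within ?S)" if "z \<in> ?S" for z
    unfolding t1_def[abs_def] t2_def v_def helm_def
    by (rule derivative_eq_intros k' \<tau>' Du that refl)+
      (simp add: t1_def algebra_simps power2_eq_square)
  have cont: "continuous_on ?S t2"
  proof -
    have "continuous_on ?S k" "continuous_on ?S \<tau>" "continuous_on ?S t1" "continuous_on ?S u"
      by (rule DERIV_continuous_on, rule k' \<tau>' t1' Du(1), assumption?)+
    moreover have "continuous_on ?S v"
      unfolding v_def helm_def using C2 \<open>continuous_on ?S u\<close>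
      by (auto intro!: continuous_intros simp: C2_on_def)
    ultimately show ?thesis unfolding t2_def[abs_def] by (intro continuous_intros)
  qed
  show ?thesis
  proof (rule that[OF t' t1' cont])
    fix U :: "real set" assume U: "open U" "U \<subseteq> {a..b} - knots N x"
    obtain v1 where v: "\<And>z. z \<in> U \<Longrightarrow> (v has_real_derivative v1 z) (at z)"
      and v1: "\<And>z. z \<in> U \<Longrightarrow> (v1 has_real_derivative \<alpha>\<^sup>2 * v z) (at z)"
      using S_space_helm_derivatives[OF u U] unfolding v_def by metis
    define t3 where "t3 z = k z * (v1 z - \<alpha> * \<tau> z * v z) - 2 * \<alpha> * \<tau> z * t2 z
        - 2 * \<alpha>\<^sup>2 * (1 - (\<tau> z)\<^sup>2) * t1 z" for z
    have t1i: "(t1 has_real_derivative t2 z) (at z)" if "z \<in> U" for z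
    proof -
      have "at z within ?S = at z" using U that by (intro at_within_open_subset[OF that]) auto
      thus ?thesis using t1'[of z] that U by auto
    qed
    have t2': "(t2 has_real_derivative t3 z) (at z)" if "z \<in> U" for z
      unfolding t2_def[abs_def] t3_def
      by (rule derivative_eq_intros k' \<tau>' t1i v that refl)+
        (simp add: t2_def algebra_simps power2_eq_square)
    \<comment> \<open>Since \<open>v1' = \<alpha>\<^sup>2 v\<close>, the derivative of
      \<open>k (v1 - \<alpha> \<tau> v)\<close> is \<open>- 2 \<alpha> \<tau>\<close> times that
      product. Expressing the product by \<open>t3\<close>, \<open>t2\<close> and \<open>t1\<close>
      makes all terms in \<open>t1\<close> cancel.\<close>
    have t3': "(t3 has_real_derivative - 4 * \<alpha> * tanh (\<alpha> * z) * t3 z - 4 * \<alpha>\<^sup>2 * t2 z) (at z)"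
      if "z \<in> U" for z
      unfolding t3_def[abs_def] \<tau>_def[symmetric]
      by (rule derivative_eq_intros k' \<tau>' t1i t2' v v1 that refl)+
        (simp add: t3_def algebra_simps power2_eq_square)
    show "\<exists>t3. \<forall>z\<in>U. (t2 has_real_derivative t3 z) (at z) \<and>
       (t3 has_real_derivative - 4 * \<alpha> * tanh (\<alpha> * z) * t3 z - 4 * \<alpha>\<^sup>2 * t2 z) (at z)"
      using t2' t3' by (intro exI[of _ t3]) auto
  qed
qed

text \<open>Off the knots the third derivative takes finitely many values, which gives the
  boundedness that a real supremum needs to be an upper bound. The second derivative is linear
  between knots, so its knot values control it everywhere.\<close>

lemma cubic_spline_sup_bounds:
  assumes ab: "a < b" and part: "is_partition a b N x"
    and \<sigma>: "is_cubic_spline_interpolant a b N x y e \<sigma>"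
    and K: "K = max (Linf_norm ({a..b} - knots N x) (Dn {a..b} 3 \<sigma>))
               (Linf_norm (knots N x) (Dn {a..b} 2 \<sigma>))"
  shows "z \<in> {a..b} - knots N x \<Longrightarrow> \<bar>Dn {a..b} 3 \<sigma> z\<bar> \<le> K"
    and "z \<in> {a..b} \<Longrightarrow> \<bar>Dn {a..b} 2 \<sigma> z\<bar> \<le> K"
proof -
  let ?S = "{a..b}"
  have "\<exists>c. \<forall>z\<in>{x (j - 1)<..<x j}. (Dn ?S 2 \<sigma> has_real_derivative c) (at z) \<and> Dn ?S 3 \<sigma> z = c"
    if j: "j \<in> {1..N}" for j
  proof -
    obtain p :: "real poly" where p: "degree p \<le> 3" "\<And>z. z \<in> {x (j - 1)..x j} \<Longrightarrow> \<sigma> z = poly p z"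
      using \<sigma> j unfolding is_cubic_spline_interpolant_def by metis
    have "{x (j - 1)<..<x j} \<subseteq> ?S" using partition_gap_no_knots[OF part j] by auto
    from cubic_spline_gap[OF open_greaterThanLessThan this p(1), of \<sigma>] p(2) show ?thesis
      by (metis greaterThanLessThan_subseteq_atLeastAtMost_iff order_refl subsetD)
  qed
  then obtain c where c: "\<And>j z. j \<in> {1..N} \<Longrightarrow> z \<in> {x (j - 1)<..<x j} \<Longrightarrow>
      (Dn ?S 2 \<sigma> has_real_derivative c j) (at z) \<and> Dn ?S 3 \<sigma> z = c j" by metis
  have "\<bar>Dn ?S 3 \<sigma> z\<bar> \<in> (\<lambda>j. \<bar>c j\<bar>) ` {1..N}" if z: "z \<in> ?S - knots N x" for z
  proof -
    obtain j where j: "j \<in> {1..N}" "z \<in> {x (j - 1)..x j}" using partition_cover[OF part ab] z by blast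
    have "j - 1 \<in> {0..N}" "j \<in> {0..N}" using j by auto
    hence "z \<noteq> x (j - 1)" "z \<noteq> x j" using z unfolding knots_def by blast+
    with j have "z \<in> {x (j - 1)<..<x j}" by auto
    with c[OF j(1) this] j show ?thesis by auto
  qed
  hence "bdd_above ((\<lambda>z. \<bar>Dn ?S 3 \<sigma> z\<bar>) ` (?S - knots N x))"
    by (intro bdd_above_mono[OF bdd_above_finite[of "(\<lambda>j. \<bar>c j\<bar>) ` {1..N}"]]) auto
  thus "\<bar>Dn ?S 3 \<sigma> z\<bar> \<le> K" if "z \<in> ?S - knots N x"
    using that unfolding K Linf_norm_def by (intro max.coboundedI1 cSUP_upper)
  have kn: "\<bar>Dn ?S 2 \<sigma> (x j)\<bar> \<le> K" if "j \<le> N" for j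
    using that unfolding K Linf_norm_def
    by (intro max.coboundedI2 cSUP_upper bdd_above_finite) (auto simp: knots_def)
  show "\<bar>Dn ?S 2 \<sigma> z\<bar> \<le> K" if z: "z \<in> ?S"
  proof -
    obtain j where j: "j \<in> {1..N}" "z \<in> {x (j - 1)..x j}" using partition_cover[OF part ab z] .
    note st = partition_step[OF part j(1)]
    have "continuous_on {x (j - 1)..x j} (Dn ?S 2 \<sigma>)"
      using \<sigma> st unfolding is_cubic_spline_interpolant_def C2_on_def
      by (auto intro: continuous_on_subset)
    \<comment> \<open>With zero forcing and zero drift, \<open>linterp_deviation\<close> leaves no
      deviation at all.\<close>
    hence "\<bar>Dn ?S 2 \<sigma> z - linterp (x (j - 1)) (x j) (Dn ?S 2 \<sigma>) z\<bar> \<le>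
        0 * (x j - x (j - 1))\<^sup>2 / 4
          + 0 * (x j - x (j - 1)) * \<bar>Dn ?S 2 \<sigma> (x j) - Dn ?S 2 \<sigma> (x (j - 1))\<bar> / 4"
      using c[OF j(1)] by (intro linterp_deviation[where ?w1.0 = "\<lambda>_. c j" and ?w2.0 = "\<lambda>_. 0"
            and \<beta> = "\<lambda>_. 0", OF st(1)] j) auto
    hence "Dn ?S 2 \<sigma> z = linterp (x (j - 1)) (x j) (Dn ?S 2 \<sigma>) z" by simp
    thus ?thesis using j by (simp only:) (intro abs_linterp_le st kn; auto)
  qed
qed

section \<open>The error estimate\<close>

text \<open>By the smallness assumption the part of \<open>7 * B\<close> containing \<open>W\<close>
  is at most \<open>W / 2\<close>; the rest is at most \<open>14 * \<alpha> * h\<^sup>2 * K\<close>,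
  whence the constant 28. The assumption is phrased with \<open>b - a\<close> to be uniform in the
  partition.\<close>

lemma spline_error_bounds:
  assumes ab: "a < b" and \<alpha>: "0 < \<alpha>" "\<alpha> \<le> 1" "14 * \<alpha> * ((b - a)\<^sup>2 + 2 * (b - a)) \<le> 1"
    and part: "is_partition a b N x"
    and t: "t \<in> T_space a b N x \<alpha>" "interpolates N x y t" "end_condition a b e t"
    and \<sigma>: "is_cubic_spline_interpolant a b N x y e \<sigma>"
    and K: "K = max (Linf_norm ({a..b} - knots N x) (Dn {a..b} 3 \<sigma>))
               (Linf_norm (knots N x) (Dn {a..b} 2 \<sigma>))"
    and i: "i \<in> {0, 1, 2}" and z: "z \<in> {a..b}"
  shows "\<bar>Dn {a..b} i (\<lambda>z. \<sigma> z - t z) z\<bar> \<le> 28 * \<alpha> * mesh_size N x ^ (4 - i) * K"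
proof -
  let ?S = "{a..b}"
  define h where "h = mesh_size N x"
  define d where "d = (\<lambda>z. \<sigma> z - t z)"
  obtain t1 t2 where t1: "\<And>z. z \<in> ?S \<Longrightarrow> (t has_real_derivative t1 z) (at z within ?S)"
    and t2: "\<And>z. z \<in> ?S \<Longrightarrow> (t1 has_real_derivative t2 z) (at z within ?S)"
    and t2c: "continuous_on ?S t2"
    and t3: "\<And>U. open U \<Longrightarrow> U \<subseteq> ?S - knots N x \<Longrightarrow>
       \<exists>t3. \<forall>z\<in>U. (t2 has_real_derivative t3 z) (at z) \<and>
       (t3 has_real_derivative - 4 * \<alpha> * tanh (\<alpha> * z) * t3 z - 4 * \<alpha>\<^sup>2 * t2 z) (at z)"
    using T_space_derivatives[OF ab t(1)] by metis
  have C2: "C2_on ?S \<sigma>" and s_interp: "interpolates N x y \<sigma>" and s_end: "end_condition a b e \<sigma>"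
    using \<sigma> by (auto simp: is_cubic_spline_interpolant_def)
  note D\<sigma> = C2_on_derivatives[OF ab C2]
  note K3 = cubic_spline_sup_bounds(1)[OF ab part \<sigma> K]
  note K2 = cubic_spline_sup_bounds(2)[OF ab part \<sigma> K]
  define d1 where "d1 z = Dn ?S 1 \<sigma> z - t1 z" for z
  define d2 where "d2 z = Dn ?S 2 \<sigma> z - t2 z" for z
  have d1: "(d has_real_derivative d1 z) (at z within ?S)" if "z \<in> ?S" for z
    unfolding d_def d1_def using that by (intro DERIV_diff D\<sigma> t1)
  have d2: "(d1 has_real_derivative d2 z) (at z within ?S)" if "z \<in> ?S" for z
    unfolding d1_def[abs_def] d2_def using that by (intro DERIV_diff D\<sigma> t2)
  have d2c: "continuous_on ?S d2"
    unfolding d2_def[abs_def] using C2 by (intro continuous_intros t2c) (simp add: C2_on_def)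
  have Dn_t: "Dn ?S 1 t z = t1 z" "Dn ?S 2 t z = t2 z" if "z \<in> ?S" for z
    using Dn_1_eqI[OF ab that t1] Dn_2_eqI[OF ab that t1 t2] that by auto
  have Dn_d: "Dn ?S 1 d z = d1 z" "Dn ?S 2 d z = d2 z" if "z \<in> ?S" for z
    using Dn_1_eqI[OF ab that d1] Dn_2_eqI[OF ab that d1 d2] that by auto
  have zero: "d (x j) = 0" if "j \<le> N" for j
    using that t(2) s_interp by (simp add: interpolates_def d_def)
  \<comment> \<open>Both interpolants share their end data: first derivatives in type I, second
    derivatives in types II and III.\<close>
  have ends: "d1 a = 0 \<and> d1 b = 0 \<or> d2 a = 0 \<and> d2 b = 0"
    using t(3) s_end ab Dn_t[of a] Dn_t[of b] by (cases e) (auto simp: d1_def d2_def)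
  \<comment> \<open>The maximum \<open>W\<close> is attained, hence finite, and can later be
    absorbed.\<close>
  obtain m where m: "m \<in> ?S" "\<And>z. z \<in> ?S \<Longrightarrow> \<bar>d2 z\<bar> \<le> \<bar>d2 m\<bar>"
    using continuous_attains_sup[OF compact_Icc _ continuous_on_rabs[OF d2c]] ab by auto
  define W where "W = \<bar>d2 m\<bar>"
  have W: "\<bar>d2 z\<bar> \<le> W" if "z \<in> ?S" for z using m that by (simp add: W_def)
  have W0: "W \<ge> 0" by (simp add: W_def)
  have K0: "K \<ge> 0" using K2[OF z] by linarith
  have "x 0 = a" "x N = b" using part by (auto simp: is_partition_def)
  hence "N \<noteq> 0" using ab by (metis less_irrefl)
  hence h0: "h > 0" using partition_step[OF part, of 1] by (auto simp: h_def)
  have hD: "h \<le> b - a"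
  proof -
    have "Max ((\<lambda>j. x j - x (j - 1)) ` {1..N}) \<le> b - a"
      using \<open>N \<noteq> 0\<close> partition_step(2,3)[OF part]
      by (intro Max.boundedI) (auto intro!: diff_mono)
    thus ?thesis by (simp add: h_def mesh_size_def)
  qed
  \<comment> \<open>The bound of \<open>linterp_deviation\<close> with drift at most
    \<open>4 * \<alpha>\<close>, end values differing by at most \<open>2 * W\<close>, and step
    length at most \<open>h\<close>.\<close>
  define B where "B = (4 * \<alpha> * K + 4 * \<alpha>\<^sup>2 * (K + W)) * h\<^sup>2 / 4 + 4 * \<alpha> * h * (2 * W) / 4"
  have dev: "\<bar>d2 z - linterp (x (j - 1)) (x j) d2 z\<bar> \<le> B"
    if j: "j \<in> {1..N}" and z: "z \<in> {x (j - 1)..x j}" for j z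
  proof -
    define p q where "p = x (j - 1)" and "q = x j"
    have pq: "p < q" "a \<le> p" "q \<le> b" "q - p \<le> h"
      using partition_step[OF part j] by (auto simp: p_def q_def h_def)
    let ?U = "{p<..<q}"
    have U: "open ?U" "?U \<subseteq> ?S - knots N x" "?U \<subseteq> ?S"
      using partition_gap_no_knots[OF part j] by (auto simp: p_def q_def)
    obtain t3 where t3: "\<And>z. z \<in> ?U \<Longrightarrow> (t2 has_real_derivative t3 z) (at z)"
      "\<And>z. z \<in> ?U \<Longrightarrow>
        (t3 has_real_derivative - 4 * \<alpha> * tanh (\<alpha> * z) * t3 z - 4 * \<alpha>\<^sup>2 * t2 z) (at z)"
      using t3[OF U(1,2)] by metis
    obtain P :: "real poly" where "degree P \<le> 3" "\<And>z. z \<in> {p..q} \<Longrightarrow> \<sigma> z = poly P z"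
      using \<sigma> j unfolding is_cubic_spline_interpolant_def p_def q_def by metis
    then obtain c where c: "\<And>z. z \<in> ?U \<Longrightarrow> (Dn ?S 2 \<sigma> has_real_derivative c) (at z)"
      "\<And>z. z \<in> ?U \<Longrightarrow> Dn ?S 3 \<sigma> z = c"
      using cubic_spline_gap[OF U(1,3), of P \<sigma>]
      by (metis greaterThanLessThan_subseteq_atLeastAtMost_iff order_refl subsetD)
    have "\<bar>d2 z - linterp p q d2 z\<bar> \<le> (4 * \<alpha> * K + 4 * \<alpha>\<^sup>2 * (K + W)) * (q - p)\<^sup>2 / 4
        + 4 * \<alpha> * (q - p) * \<bar>d2 q - d2 p\<bar> / 4"
    proof (rule linterp_deviation[where ?w1.0 = "\<lambda>z. c - t3 z"
          and ?w2.0 = "\<lambda>z. 4 * \<alpha> * tanh (\<alpha> * z) * t3 z + 4 * \<alpha>\<^sup>2 * t2 z"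
          and \<beta> = "\<lambda>z. 4 * \<alpha> * tanh (\<alpha> * z)", OF pq(1)])
      show "continuous_on {p..q} d2" using pq by (intro continuous_on_subset[OF d2c]) auto
      show "z \<in> {p..q}" using that by (simp add: p_def q_def)
      \<comment> \<open>Smallness gives \<open>28 * \<alpha> * (b - a) \<le> 1\<close>, so the drift
        condition holds even with 1/7.\<close>
      have "4 * \<alpha> * (q - p) \<le> 4 * \<alpha> * (b - a)" using pq \<alpha> by (intro mult_left_mono) auto
      moreover have "0 \<le> \<alpha> * (b - a)\<^sup>2" using \<alpha> by simp
      moreover have "14 * (\<alpha> * (b - a)\<^sup>2) + 28 * \<alpha> * (b - a) \<le> 1"
        using \<alpha>(3) by (simp add: algebra_simps)
      ultimately show "4 * \<alpha> * (q - p) < 1" by linarith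
    next
      fix y assume y: "y \<in> ?U"
      show "(d2 has_real_derivative c - t3 y) (at y)"
        unfolding d2_def[abs_def] using y by (intro DERIV_diff c t3)
      show "((\<lambda>z. c - t3 z) has_real_derivative 4 * \<alpha> * tanh (\<alpha> * y) * t3 y + 4 * \<alpha>\<^sup>2 * t2 y) (at y)"
        by (auto intro!: derivative_eq_intros t3 y)
      have tanh: "\<bar>tanh (\<alpha> * y)\<bar> \<le> 1" using tanh_real_bounds[of "\<alpha> * y"] by auto
      thus tanh': "\<bar>4 * \<alpha> * tanh (\<alpha> * y)\<bar> \<le> 4 * \<alpha>" using \<alpha> by (simp add: abs_mult)
      have yS: "y \<in> ?S" "y \<in> ?S - knots N x" using y U by auto
      have "\<bar>4 * \<alpha> * tanh (\<alpha> * y) * c\<bar> \<le> 4 * \<alpha> * K"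
        unfolding abs_mult[of _ c] using tanh' K3[OF yS(2)] c(2)[OF y] \<alpha> by (intro mult_mono) auto
      moreover have "\<bar>4 * \<alpha>\<^sup>2 * t2 y\<bar> \<le> 4 * \<alpha>\<^sup>2 * (K + W)"
        using K2[OF yS(1)] W[OF yS(1)] unfolding abs_mult d2_def by (intro mult_mono) auto
      \<comment> \<open>The terms in \<open>t3\<close>, which has no a priori bound, cancel; only
        multiples of \<open>c\<close> and \<open>t2\<close> remain.\<close>
      ultimately show "\<bar>4 * \<alpha> * tanh (\<alpha> * y) * t3 y + 4 * \<alpha>\<^sup>2 * t2 y
          + 4 * \<alpha> * tanh (\<alpha> * y) * (c - t3 y)\<bar> \<le> 4 * \<alpha> * K + 4 * \<alpha>\<^sup>2 * (K + W)"
        by (simp add: algebra_simps)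
    qed
    also have "\<dots> \<le> B"
    proof -
      have "\<bar>d2 q - d2 p\<bar> \<le> 2 * W" using W[of p] W[of q] pq by auto
      moreover have "(q - p)\<^sup>2 \<le> h\<^sup>2" using pq by (intro power_mono) auto
      ultimately show ?thesis unfolding B_def using pq \<alpha> K0 W0 h0
        by (intro add_mono divide_right_mono mult_mono) auto
    qed
    finally show ?thesis by (simp add: p_def q_def)
  qed
  have W7: "W \<le> 7 * B"
    using vanishing_knots_second_derivative[OF part ab d1 d2 zero ends dev m(1)] by (simp add: W_def)
  have "B \<le> 2 * \<alpha> * h\<^sup>2 * K + \<alpha> * ((b - a)\<^sup>2 + 2 * (b - a)) * W"
  proof -
    \<comment> \<open>Replacing the square by \<open>\<alpha>\<close> merges the two terms in
      \<open>K\<close>; the final estimate is therefore linear in \<open>\<alpha>\<close>.\<close>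
    have a2: "\<alpha>\<^sup>2 \<le> \<alpha>" using \<alpha> by (simp add: power2_eq_square mult_left_le)
    have "B = \<alpha> * h\<^sup>2 * K + \<alpha>\<^sup>2 * (h\<^sup>2 * K) + \<alpha>\<^sup>2 * (h\<^sup>2 * W) + 2 * \<alpha> * (h * W)"
      by (simp add: B_def field_simps)
    also have "\<dots> \<le> \<alpha> * h\<^sup>2 * K + \<alpha> * (h\<^sup>2 * K) + \<alpha> * ((b - a)\<^sup>2 * W) + 2 * \<alpha> * ((b - a) * W)"
      using a2 \<alpha> h0 hD K0 W0 by (intro add_mono mult_mono power_mono) auto
    finally show ?thesis by (simp add: algebra_simps)
  qed
  moreover have "14 * \<alpha> * ((b - a)\<^sup>2 + 2 * (b - a)) * W \<le> 1 * W"
    by (intro mult_right_mono \<alpha> W0)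
  ultimately have Wle: "W \<le> 28 * \<alpha> * h\<^sup>2 * K" using W7 by linarith
  note small = vanishing_knots_bounds[OF part ab d1 d2 W zero z, folded h_def]
  consider "i = 0" | "i = 1" | "i = 2" using i by auto
  thus ?thesis unfolding d_def[symmetric] h_def[symmetric]
  proof cases
    case 1
    have "\<bar>d z\<bar> \<le> W * h\<^sup>2" using small(2) by simp
    also have "\<dots> \<le> 28 * \<alpha> * h\<^sup>2 * K * h\<^sup>2" using Wle by (intro mult_right_mono) auto
    finally show "\<bar>Dn ?S i d z\<bar> \<le> 28 * \<alpha> * h ^ (4 - i) * K"
      using 1 by (simp add: eval_nat_numeral mult_ac)
  next
    case 2
    have "\<bar>d1 z\<bar> \<le> W * h" using small(1) by simp
    also have "\<dots> \<le> 28 * \<alpha> * h\<^sup>2 * K * h" using Wle h0 by (intro mult_right_mono) auto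
    finally show "\<bar>Dn ?S i d z\<bar> \<le> 28 * \<alpha> * h ^ (4 - i) * K"
      using 2 Dn_d(1)[OF z] by (simp add: eval_nat_numeral mult_ac)
  next
    case 3
    show "\<bar>Dn ?S i d z\<bar> \<le> 28 * \<alpha> * h ^ (4 - i) * K"
      using 3 Dn_d(2)[OF z] W[OF z] Wle by simp
  qed
qed

text \<open>The threshold depends only on \<open>b - a\<close>. The constant is chosen after
  \<open>\<alpha>\<close>: it depends on \<open>\<alpha>\<close> and \<open>i\<close>, but not on
  the partition or the data.\<close>

theorem theorem2:
  fixes a b :: real and i :: nat
  assumes "a < b" and "i \<in> {0, 1, 2}"
  shows "\<exists>\<alpha>\<^sub>0>0. \<forall>\<alpha>. 0 < \<alpha> \<and> \<alpha> < \<alpha>\<^sub>0 \<longrightarrow>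
    (\<exists>C>0. \<forall>N x y e t \<sigma>.
       is_partition a b N x \<and>
       t \<in> T_space a b N x \<alpha> \<and> interpolates N x y t \<and> end_condition a b e t \<and>
       is_cubic_spline_interpolant a b N x y e \<sigma> \<longrightarrow>
       Linf_norm {a..b} (Dn {a..b} i (\<lambda>z. \<sigma> z - t z))
         \<le> C * (\<alpha> * mesh_size N x) ^ (4 - i) *
           max (Linf_norm ({a..b} - knots N x) (Dn {a..b} 3 \<sigma>))
               (Linf_norm (knots N x) (Dn {a..b} 2 \<sigma>)))"
proof -
  define D where "D = 14 * ((b - a)\<^sup>2 + 2 * (b - a))"
  have D: "D > 0" using assms by (simp add: D_def add_pos_pos)
  show ?thesis
  proof (rule exI[of _ "min 1 (1 / D)"], intro conjI allI impI)
    show "0 < min 1 (1 / D)" using D by simp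
    fix \<alpha> :: real assume \<alpha>: "0 < \<alpha> \<and> \<alpha> < min 1 (1 / D)"
    hence "\<alpha> * D \<le> 1" using D by (simp add: field_simps)
    hence small: "0 < \<alpha>" "\<alpha> \<le> 1" "14 * \<alpha> * ((b - a)\<^sup>2 + 2 * (b - a)) \<le> 1"
      using \<alpha> by (auto simp: D_def mult_ac)
    \<comment> \<open>The denominator cancels the power of \<open>\<alpha>\<close> in the claim,
      leaving the linear factor of \<open>spline_error_bounds\<close>.\<close>
    define C where "C = 28 * \<alpha> / \<alpha> ^ (4 - i)"
    have "C > 0" using \<alpha> by (simp add: C_def)
    moreover have "Linf_norm {a..b} (Dn {a..b} i (\<lambda>z. \<sigma> z - t z))
         \<le> C * (\<alpha> * mesh_size N x) ^ (4 - i) *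
           max (Linf_norm ({a..b} - knots N x) (Dn {a..b} 3 \<sigma>))
               (Linf_norm (knots N x) (Dn {a..b} 2 \<sigma>))"
      if "is_partition a b N x" "t \<in> T_space a b N x \<alpha>" "interpolates N x y t"
        "end_condition a b e t" "is_cubic_spline_interpolant a b N x y e \<sigma>"
      for N x y e t \<sigma>
    proof -
      have "C * (\<alpha> * mesh_size N x) ^ (4 - i) = 28 * \<alpha> * mesh_size N x ^ (4 - i)"
        using \<alpha> by (simp add: C_def power_mult_distrib)
      thus ?thesis
        unfolding Linf_norm_def[of "{a..b}"] using \<open>a < b\<close>
        by (auto intro!: cSUP_least spline_error_bounds[OF \<open>a < b\<close> small that refl assms(2)])
    qed
    ultimately show "\<exists>C>0. \<forall>N x y e t \<sigma>.
       is_partition a b N x \<and>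
       t \<in> T_space a b N x \<alpha> \<and> interpolates N x y t \<and> end_condition a b e t \<and>
       is_cubic_spline_interpolant a b N x y e \<sigma> \<longrightarrow>
       Linf_norm {a..b} (Dn {a..b} i (\<lambda>z. \<sigma> z - t z))
         \<le> C * (\<alpha> * mesh_size N x) ^ (4 - i) *
           max (Linf_norm ({a..b} - knots N x) (Dn {a..b} 3 \<sigma>))
               (Linf_norm (knots N x) (Dn {a..b} 2 \<sigma>))"
      by blast
  qed
qed

end
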